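(* Let $f:H\to\mathbb{R}$ be $\mu$-strongly convex ($\mu>0$) and twice differentiable, with minimum value $f^*$. Pick $m\ge\frac12$ and let $$\alpha\in\left(0,3\sqrt{\tfrac{\mu m}{2}}\right],\qquad \beta>0,\qquad \gamma=m\left(1+\tfrac13\alpha\beta\right)+\tfrac13\alpha\beta.$$ Let $x:[0,\infty)\to H$ satisfy $$\ddot{x}(t)+\alpha\dot{x}(t)+\beta\nabla^2 f(x(t))\dot{x}(t)+\gamma\nabla f(x(t))=0$$ with $x(0)=x_0$ and $\dot{x}(0)=v_0$. If $v_0=-\beta\nabla f(x_0)$, then for every $t\ge 0$, $$f(x(t))-f^*\le\left(1+\frac{6}{\alpha\beta}\right)\left(f(x_0)-f^*\right)e^{-\frac23\alpha t},$$ and moreover $$\int_0^\infty e^{\frac{2\alpha}{3}t}\|\nabla f(x(t))\|^2\,dt<\infty.$$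
   Context: $H$ is a real Hilbert space with inner product $\langle\cdot,\cdot\rangle$ and norm $\|\cdot\|$. The function $f$ attains its minimum $f^*=\min(f)$. A differentiable $f$ is $\mu$-strongly convex if $f(y)\ge f(x)+\langle\nabla f(x),y-x\rangle+\frac{\mu}{2}\|x-y\|^2$ for all $x,y\in H$. *)

theory Defs
  imports "HOL-Analysis.Analysis"
begin

text \<open>
  A real Hilbert space is a type of sort \<open>{real_inner, complete_space}\<close>. The gradient is the Riesz
  representative of the Frechet derivative; its existence on a Hilbert space is
  \<open>differentiable_GDERIV_gradient\<close> below.
\<close>

definition gradient :: "('a::real_inner \<Rightarrow> real) \<Rightarrow> 'a \<Rightarrow> 'a"
  where "gradient f x = (THE D. GDERIV f x :> D)"

definition hessian :: "('a::real_inner \<Rightarrow> real) \<Rightarrow> 'a \<Rightarrow> 'a \<Rightarrow> 'a"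
  where "hessian f x = frechet_derivative (gradient f) (at x)"

definition twice_differentiable :: "('a::real_inner \<Rightarrow> real) \<Rightarrow> bool"
  where "twice_differentiable f \<longleftrightarrow>
    (\<forall>x. f differentiable (at x)) \<and> (\<forall>x. gradient f differentiable (at x))"

definition strongly_convex :: "real \<Rightarrow> ('a::real_inner \<Rightarrow> real) \<Rightarrow> bool"
  where "strongly_convex \<mu> f \<longleftrightarrow>
    (\<forall>x. f differentiable (at x)) \<and>
    (\<forall>x y. f y \<ge> f x + inner (gradient f x) (y - x) + \<mu> / 2 * (norm (x - y))\<^sup>2)"

lemma GDERIV_unique:
  assumes "GDERIV f x :> D" "GDERIV f x :> E"
  shows "D = E"
proof -
  have "(\<lambda>h. inner h D) = (\<lambda>h. inner h E)"
    using assms unfolding gderiv_def by (rule has_derivative_unique)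
  then have "inner h (D - E) = 0" for h
    by (metis eq_iff_diff_eq_0 inner_diff_right)
  then show ?thesis
    by (metis eq_iff_diff_eq_0 inner_eq_zero_iff)
qed

lemma gradient_eqI: "GDERIV f x :> D \<Longrightarrow> gradient f x = D"
  unfolding gradient_def by (blast intro: GDERIV_unique)

lemma riesz_representation:
  fixes \<phi> :: "'a::{real_inner, complete_space} \<Rightarrow> real"
  assumes "bounded_linear \<phi>"
  shows "\<exists>D. \<forall>h. \<phi> h = inner h D"
proof -
  interpret bounded_linear \<phi> by fact
  obtain K where K: "\<And>y. \<bar>\<phi> y\<bar> \<le> norm y * K"
    using bounded by (auto simp: real_norm_def)
  define J where "J y = (norm y)\<^sup>2 / 2 - \<phi> y" for y
  have lower: "J y \<ge> - (K\<^sup>2 / 2)" for y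
  proof -
    have "0 \<le> (norm y - K)\<^sup>2" by simp
    then have "norm y * K - (norm y)\<^sup>2 / 2 \<le> K\<^sup>2 / 2"
      by (simp add: power2_diff field_simps)
    then show ?thesis using K[of y] unfolding J_def by linarith
  qed
  define m where "m = Inf (range J)"
  have bdd: "bdd_below (range J)" using lower by (auto intro!: bdd_belowI)
  have m_le: "m \<le> J y" for y
    unfolding m_def using bdd by (auto intro: cInf_lower)
  have "\<exists>y. J y < m + inverse (real (Suc n))" for n
    using cInf_lessD[of "range J" "m + inverse (real (Suc n))"] unfolding m_def by auto
  then obtain s where s: "\<And>n. J (s n) < m + inverse (real (Suc n))" by metis
  have mid: "J ((1/2) *\<^sub>R (u + v)) = (J u + J v) / 2 - (norm (u - v))\<^sup>2 / 8" for u v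
    unfolding J_def power2_norm_eq_inner
    by (simp add: add scaleR inner_add_left inner_add_right inner_diff_left inner_diff_right
        inner_commute field_simps)
  have close: "(norm (u - v))\<^sup>2 \<le> 4 * (J u - m) + 4 * (J v - m)" for u v
    using mid[of u v] m_le[of "(1/2) *\<^sub>R (u + v)"] by argo
  have "Cauchy s"
    unfolding Cauchy_iff
  proof (intro allI impI)
    fix e :: real assume "e > 0"
    then obtain M where M: "inverse (real (Suc M)) < e\<^sup>2 / 8"
      using reals_Archimedean[of "e\<^sup>2 / 8"] by auto
    have small: "J (s n) - m < e\<^sup>2 / 8" if "n \<ge> M" for n
    proof -
      have "inverse (real (Suc n)) \<le> inverse (real (Suc M))" using that by (simp add: le_imp_inverse_le)
      then show ?thesis using s[of n] M by linarith
    qed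
    show "\<exists>M. \<forall>p\<ge>M. \<forall>q\<ge>M. norm (s p - s q) < e"
    proof (intro exI allI impI)
      fix p q assume pq: "p \<ge> M" "q \<ge> M"
      have "(norm (s p - s q))\<^sup>2 < e\<^sup>2"
        using close[of "s p" "s q"] small[OF pq(1)] small[OF pq(2)] by argo
      then show "norm (s p - s q) < e"
        using \<open>e > 0\<close> by (simp add: power2_less_imp_less)
    qed
  qed
  then obtain y where y: "s \<longlonglongrightarrow> y" using Cauchy_convergent convergent_def by blast
  have "(\<lambda>n. J (s n)) \<longlonglongrightarrow> J y"
    unfolding J_def by (intro tendsto_intros tendsto y) simp
  moreover have "(\<lambda>n. m + inverse (real (Suc n))) \<longlonglongrightarrow> m"
    using tendsto_add[OF tendsto_const LIMSEQ_inverse_real_of_nat, of m] by simp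
  ultimately have "J y \<le> m"
    by (rule LIMSEQ_le) (use s in \<open>auto intro: less_imp_le\<close>)
  then have y_min: "J y \<le> J z" for z using m_le[of z] by linarith
  have "\<phi> h = inner h y" for h
  proof -
    define c where "c = inner h y - \<phi> h"
    have quad: "0 \<le> t * c + t\<^sup>2 / 2 * (norm h)\<^sup>2" for t
    proof -
      have "J (y + t *\<^sub>R h) = J y + t * c + t\<^sup>2 / 2 * (norm h)\<^sup>2"
        unfolding J_def c_def power2_norm_eq_inner
        by (simp add: add scaleR inner_add_left inner_add_right inner_commute algebra_simps
            power2_eq_square add_divide_distrib)
      then show ?thesis using y_min[of "y + t *\<^sub>R h"] by linarith
    qed
    define t where "t = - c / (1 + (norm h)\<^sup>2)"
    have pos: "1 + (norm h)\<^sup>2 > 0" by (simp add: add_pos_nonneg)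
    have ct: "c = - t * (1 + (norm h)\<^sup>2)" unfolding t_def using pos by simp
    have "0 \<le> t\<^sup>2 * (- 1 - (norm h)\<^sup>2 / 2)"
      using quad[of t] unfolding ct by (simp add: power2_eq_square algebra_simps)
    moreover have "- 1 - (norm h)\<^sup>2 / 2 < 0" using pos by (smt (verit) zero_le_power2 divide_nonneg_pos)
    ultimately have "t = 0" by (smt (verit) mult_pos_neg zero_less_power2)
    then show ?thesis using ct unfolding c_def by simp
  qed
  then show ?thesis by blast
qed

lemma differentiable_GDERIV_gradient:
  fixes f :: "'a::{real_inner, complete_space} \<Rightarrow> real"
  assumes "f differentiable (at x)"
  shows "GDERIV f x :> gradient f x"
proof -
  obtain F where F: "(f has_derivative F) (at x)"
    using assms unfolding differentiable_def by blast
  obtain D where "\<forall>h. F h = inner h D"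
    using riesz_representation[OF has_derivative_bounded_linear[OF F]] by blast
  then have "F = (\<lambda>h. inner h D)" by blast
  then have "GDERIV f x :> D" using F unfolding gderiv_def by simp
  then show ?thesis using gradient_eqI by metis
qed

lemma twice_differentiable_has_derivative_hessian:
  "twice_differentiable f \<Longrightarrow> (gradient f has_derivative hessian f x) (at x)"
  unfolding twice_differentiable_def hessian_def by (simp flip: frechet_derivative_works)

end

theory Submission
  imports Defs
begin

text \<open>
  Write \<open>g = \<nabla>f(x)\<close>, \<open>r = 2\<alpha>/3\<close>, \<open>\<delta> = 1 + \<alpha>\<beta>/3\<close>, and let \<open>z\<close> be the minimizer. In terms of
  \<open>w = x' + \<beta> g\<close> the Hessian disappears from the equation: \<open>w' = - \<alpha> w + (\<alpha>\<beta> - \<gamma>) g\<close>.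
  The choice of \<open>\<gamma>\<close> gives \<open>v = r (x - z) + w\<close> the derivative \<open>- (\<alpha>/3) w - m \<delta> g\<close>, so the energy
  \<open>E = m \<delta> (f(x) - f*) + |v|^2 / 2 - (\<alpha>^2/9) |x - z|^2\<close> satisfies \<open>E' + r E \<le> - \<kappa> |g|^2\<close> with
  \<open>\<kappa> = \<alpha> m \<beta>^2 / 3\<close>. Quadratic growth gives \<open>(\<alpha>^2/9) |x - z|^2 \<le> m (f(x) - f*)\<close>, hence
  \<open>E \<ge> m (\<alpha>\<beta>/3) (f(x) - f*)\<close>; the initial velocity makes \<open>w(0) = 0\<close>, hence
  \<open>E(0) \<le> m (2 + \<alpha>\<beta>/3) (f(x0) - f*)\<close>. Integrating the derivative of \<open>exp(r t) E(t)\<close> gives both claims.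
\<close>

section \<open>Strong convexity at the minimizer and the pointwise energy estimate\<close>

lemma gradient_at_minimum:
  fixes f :: "'a::{real_inner, complete_space} \<Rightarrow> real"
  assumes "f differentiable (at z)" "\<And>y. f z \<le> f y"
  shows "gradient f z = 0"
proof -
  have "(f has_derivative (\<lambda>h. inner h (gradient f z))) (at z)"
    using differentiable_GDERIV_gradient[OF assms(1)] unfolding gderiv_def .
  then have "(\<lambda>h. inner h (gradient f z)) = (\<lambda>h. 0)"
    by (rule has_derivative_local_min) (simp add: assms(2))
  then have "inner (gradient f z) (gradient f z) = 0" by meson
  then show ?thesis by simp
qed

lemma strongly_convex_quadratic_growth:
  fixes f :: "'a::{real_inner, complete_space} \<Rightarrow> real"
  assumes "strongly_convex \<mu> f" "\<And>y. f z \<le> f y"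
  shows "\<mu> / 2 * (norm (y - z))\<^sup>2 \<le> f y - f z"
proof -
  have "gradient f z = 0"
    using assms by (intro gradient_at_minimum) (auto simp: strongly_convex_def)
  moreover have "f y \<ge> f z + inner (gradient f z) (y - z) + \<mu> / 2 * (norm (z - y))\<^sup>2"
    using assms(1) by (auto simp: strongly_convex_def)
  ultimately show ?thesis by (simp add: norm_minus_commute)
qed

text \<open>Along the trajectory the left side is exactly \<open>E' + r E\<close>, with
  \<open>y = x - z\<close> and every \<open>w\<close> term cancelled. The bound on \<open>F\<close>
  cancels \<open>m \<delta> Y\<close> and leaves a small multiple of \<open>Y\<close>, which Young's
  inequality splits between \<open>N\<close> and \<open>G\<close>.\<close>

lemma energy_inequality:
  fixes \<alpha> \<beta> \<mu> m F :: real and y g :: "'a::real_inner"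
  assumes "\<alpha> > 0" "\<beta> > 0" "\<mu> > 0" "m \<ge> 1 / 2" "\<alpha>\<^sup>2 / 9 \<le> \<mu> * m / 2"
    and F: "F \<le> inner y g - \<mu> / 2 * (norm y)\<^sup>2"
  defines "\<delta> \<equiv> 1 + \<alpha> * \<beta> / 3"
  shows "2 * \<alpha> / 3 * (m * \<delta> * F - (m * \<delta> - \<alpha> * \<beta> / 3) * inner y g + \<alpha>\<^sup>2 / 9 * (norm y)\<^sup>2)
      - m * \<delta> * \<beta> * (norm g)\<^sup>2 \<le> - (\<alpha> * m * \<beta>\<^sup>2 / 3 * (norm g)\<^sup>2)"
proof -
  define Y where "Y = inner y g"
  define N where "N = (norm y)\<^sup>2"
  define G where "G = (norm g)\<^sup>2"
  \<comment> \<open>Young weight for the term \<open>(2\<alpha>/3) (\<alpha>\<beta>/3) Y\<close> left over after the bound on \<open>F\<close>: it costs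
    \<open>m \<beta> G\<close> and so leaves \<open>(\<alpha> m \<beta>^2 / 3) G\<close> of the available \<open>m \<delta> \<beta> G\<close>.\<close>
  define s where "s = \<alpha>\<^sup>2 / (9 * m)"
  have m: "m > 0" using assms(4) by simp
  have N0: "N \<ge> 0" unfolding N_def by simp
  have "0 \<le> (norm (s *\<^sub>R y - g))\<^sup>2" by simp
  also have "\<dots> = s\<^sup>2 * N - 2 * s * Y + G"
    unfolding Y_def N_def G_def power2_norm_eq_inner
    by (simp add: inner_diff_left inner_diff_right inner_commute power2_eq_square algebra_simps)
  finally have "m * \<beta> * (2 * s * Y) \<le> m * \<beta> * (s\<^sup>2 * N + G)"
    using m assms(2) by (intro mult_left_mono) auto
  moreover have "m * \<beta> * (2 * s * Y) = 2 * \<alpha>\<^sup>2 * \<beta> / 9 * Y"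
    using m unfolding s_def by simp
  ultimately have young: "2 * \<alpha>\<^sup>2 * \<beta> / 9 * Y \<le> m * \<beta> * s\<^sup>2 * N + m * \<beta> * G"
    by (simp only: distrib_left mult.assoc)
  \<comment> \<open>The hypothesis \<open>m \<ge> 1 / 2\<close> enters here: it turns
    \<open>s \<le> \<mu> / 2\<close> into \<open>s \<le> \<mu> * m\<close>.\<close>
  have "s \<le> \<mu> / 2"
    using assms(5) m unfolding s_def by (simp add: field_simps)
  also have "\<dots> \<le> \<mu> * m" using assms(3,4) by simp
  finally have "s * (\<alpha>\<^sup>2 * \<beta> / 9 * N) \<le> \<mu> * m * (\<alpha>\<^sup>2 * \<beta> / 9 * N)"
    using N0 assms(2) by (intro mult_right_mono) auto
  moreover have "s * (\<alpha>\<^sup>2 * \<beta> / 9 * N) = m * \<beta> * s\<^sup>2 * N"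
    using m unfolding s_def by (simp add: power2_eq_square)
  ultimately have s2: "m * \<beta> * s\<^sup>2 * N \<le> \<mu> * m * (\<alpha>\<^sup>2 * \<beta> / 9 * N)" by metis
  have \<delta>: "\<delta> > 0" unfolding \<delta>_def using assms(1,2) by (simp add: add_pos_pos)
  \<comment> \<open>The term \<open>- \<mu> / 2 * N\<close> carries the factor
    \<open>\<delta>\<close>: its summand 1 pays for \<open>\<alpha>\<^sup>2 / 9 * N\<close>, its
    summand \<open>\<alpha> * \<beta> / 3\<close> for the \<open>N\<close> part of Young's
    inequality.\<close>
  have "2 * \<alpha> / 3 * (m * \<delta>) * F \<le> 2 * \<alpha> / 3 * (m * \<delta>) * (Y - \<mu> / 2 * N)"
    using F \<delta> m assms(1) unfolding Y_def N_def by (intro mult_left_mono) auto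
  moreover have "2 * \<alpha> / 3 * N * (\<alpha>\<^sup>2 / 9) \<le> 2 * \<alpha> / 3 * N * (\<mu> * m / 2)"
    using N0 assms(1) by (intro mult_left_mono assms(5)) auto
  ultimately show ?thesis
    using young s2 unfolding Y_def[symmetric] N_def[symmetric] G_def[symmetric] \<delta>_def
    by (simp add: algebra_simps power2_eq_square add_divide_distrib diff_divide_distrib)
qed

section \<open>Derivatives along a curve and integrals over the half-line\<close>

lemma has_vector_derivative_GDERIV_compose:
  assumes "(x has_vector_derivative x') (at t within S)" "GDERIV f (x t) :> D"
  shows "((\<lambda>t. f (x t)) has_real_derivative inner x' D) (at t within S)"
proof -
  have "((\<lambda>t. f (x t)) has_derivative (\<lambda>h. inner (h *\<^sub>R x') D)) (at t within S)"
    using has_derivative_compose[OF assms(1)[unfolded has_vector_derivative_def]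
        assms(2)[unfolded gderiv_def]] .
  then show ?thesis
    by (simp add: has_field_derivative_def mult_commute_abs)
qed

lemma has_real_derivative_half_norm_square:
  fixes v :: "real \<Rightarrow> 'a::real_inner"
  assumes "(v has_vector_derivative v') (at t within S)"
  shows "((\<lambda>t. (norm (v t))\<^sup>2 / 2) has_real_derivative inner (v t) v') (at t within S)"
proof -
  have "((\<lambda>t. inner (v t) (v t)) has_derivative
      (\<lambda>h. inner (v t) (h *\<^sub>R v') + inner (h *\<^sub>R v') (v t))) (at t within S)"
    using assms unfolding has_vector_derivative_def by (intro has_derivative_inner)
  then have "((\<lambda>t. inner (v t) (v t)) has_real_derivative 2 * inner (v t) v') (at t within S)"
    unfolding has_field_derivative_def
    by (rule has_derivative_eq_rhs) (auto simp: inner_commute)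
  from DERIV_cdivide[OF this, of 2] show ?thesis
    by (simp add: power2_norm_eq_inner)
qed

text \<open>The fundamental theorem for the gauge integral makes \<open>\<Psi>'\<close> integrable
  just because it is a derivative; the pointwise bound then compares it with
  \<open>- h\<close>.\<close>

lemma integral_le_of_derivative_le:
  fixes \<Psi> h :: "real \<Rightarrow> real"
  assumes "\<And>t. t \<ge> 0 \<Longrightarrow> (\<Psi> has_real_derivative \<Psi>' t) (at t within {0..})"
    and "\<And>t. t \<ge> 0 \<Longrightarrow> \<Psi>' t \<le> - h t"
    and "continuous_on {0..} h" "T \<ge> 0"
  shows "integral {0..T} h \<le> \<Psi> 0 - \<Psi> T"
proof -
  have "(\<Psi>' has_integral (\<Psi> T - \<Psi> 0)) {0..T}"
  proof (rule fundamental_theorem_of_calculus)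
    fix t assume "t \<in> {0..T}"
    then have "(\<Psi> has_real_derivative \<Psi>' t) (at t within {0..T})"
      by (intro DERIV_subset[OF assms(1)]) auto
    then show "(\<Psi> has_vector_derivative \<Psi>' t) (at t within {0..T})"
      by (simp add: has_real_derivative_iff_has_vector_derivative)
  qed (use assms in auto)
  moreover have "(h has_integral integral {0..T} h) {0..T}"
    by (intro integrable_integral integrable_continuous_real continuous_on_subset[OF assms(3)]) auto
  then have "((\<lambda>t. - h t) has_integral - integral {0..T} h) {0..T}"
    by (rule has_integral_neg)
  ultimately have "\<Psi> T - \<Psi> 0 \<le> - integral {0..T} h"
    using assms(2) by (auto intro: has_integral_le)
  then show ?thesis by simp
qed

text \<open>Monotone convergence along the intervals \<open>{0..real n}\<close> carries a uniform
  bound on gauge integrals over to the Lebesgue integral on the half-line.\<close>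

lemma nn_integral_atLeast_le:
  fixes h :: "real \<Rightarrow> real"
  assumes cont: "continuous_on {0..} h" and nonneg: "\<And>t. t \<ge> 0 \<Longrightarrow> h t \<ge> 0"
    and bound: "\<And>T. T \<ge> 0 \<Longrightarrow> integral {0..T} h \<le> C"
  shows "(\<integral>\<^sup>+t\<in>{0..}. ennreal (h t) \<partial>lborel) \<le> ennreal C"
proof -
  define u where "u n t = ennreal (h t) * indicator {0..real n} t" for n t
  have meas: "u n \<in> borel_measurable lborel" for n
  proof -
    \<comment> \<open>Continuity of \<open>h\<close> is known only on \<open>{0..}\<close>, so the
      indicator is moved inside \<open>ennreal\<close> before measurability is derived.\<close>
    have "(\<lambda>t. indicator {0..real n} t *\<^sub>R h t) \<in> borel_measurable borel"
      by (intro borel_measurable_continuous_on_indicator continuous_on_subset[OF cont]) auto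
    then have "(\<lambda>t. ennreal (indicator {0..real n} t *\<^sub>R h t)) \<in> borel_measurable lborel" by simp
    moreover have "u n = (\<lambda>t. ennreal (indicator {0..real n} t *\<^sub>R h t))"
      by (auto simp: u_def fun_eq_iff split: split_indicator)
    ultimately show ?thesis by simp
  qed
  have "(SUP n. u n t) = ennreal (h t) * indicator {0..} t" for t
  proof (rule antisym)
    show "(SUP n. u n t) \<le> ennreal (h t) * indicator {0..} t"
      by (rule SUP_least) (auto simp: u_def split: split_indicator)
    obtain n where "t \<le> real n" using real_arch_simple by blast
    then have "ennreal (h t) * indicator {0..} t = u n t"
      by (auto simp: u_def split: split_indicator)
    then show "ennreal (h t) * indicator {0..} t \<le> (SUP n. u n t)"
      by (metis SUP_upper UNIV_I)
  qed
  then have "(\<integral>\<^sup>+t\<in>{0..}. ennreal (h t) \<partial>lborel) = (\<integral>\<^sup>+t. (SUP n. u n t) \<partial>lborel)"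
    by simp
  also have "\<dots> = (SUP n. \<integral>\<^sup>+t. u n t \<partial>lborel)"
  proof (rule nn_integral_monotone_convergence_SUP)
    show "incseq u"
      by (auto simp: incseq_def le_fun_def u_def split: split_indicator)
  qed (rule meas)
  also have "\<dots> \<le> ennreal C"
  proof (rule SUP_least)
    fix n
    have "(h has_integral integral {0..real n} h) {0..real n}"
      by (intro integrable_integral integrable_continuous_real continuous_on_subset[OF cont]) auto
    then have "(\<integral>\<^sup>+t. u n t \<partial>lborel) = ennreal (integral {0..real n} h)"
      unfolding u_def by (intro nn_integral_has_integral_lebesgue') (auto simp: nonneg)
    then show "(\<integral>\<^sup>+t. u n t \<partial>lborel) \<le> ennreal C"
      using bound[of "real n"] by (simp add: ennreal_leI)
  qed
  finally show ?thesis .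
qed

text \<open>Derivatives are taken within \<open>{0..}\<close>, hence one-sided at 0. Convergence of
  the improper integral is stated as finiteness of a nonnegative integral.\<close>

theorem theorem4:
  fixes f :: "'a::{real_inner, complete_space} \<Rightarrow> real"
    and \<mu> m \<alpha> \<beta> \<gamma> fstar :: real
    and x x' x'' :: "real \<Rightarrow> 'a"
    and x0 v0 :: 'a
  assumes "\<mu> > 0"
    and "strongly_convex \<mu> f"
    and "twice_differentiable f"
    and "\<exists>z. f z = fstar" and "\<forall>y. fstar \<le> f y"
    and "m \<ge> 1 / 2"
    and "\<alpha> \<in> {0<..3 * sqrt (\<mu> * m / 2)}"
    and "\<beta> > 0"
    and "\<gamma> = m * (1 + 1 / 3 * \<alpha> * \<beta>) + 1 / 3 * \<alpha> * \<beta>"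
    and "\<forall>t\<ge>0. (x has_vector_derivative x' t) (at t within {0..})"
    and "\<forall>t\<ge>0. (x' has_vector_derivative x'' t) (at t within {0..})"
    and "\<forall>t\<ge>0. x'' t + \<alpha> *\<^sub>R x' t + \<beta> *\<^sub>R hessian f (x t) (x' t) + \<gamma> *\<^sub>R gradient f (x t) = 0"
    and "x 0 = x0" and "x' 0 = v0"
    and "v0 = - \<beta> *\<^sub>R gradient f x0"
  shows "(\<forall>t\<ge>0. f (x t) - fstar \<le> (1 + 6 / (\<alpha> * \<beta>)) * (f x0 - fstar) * exp (- (2 / 3) * \<alpha> * t)) \<and>
    (\<integral>\<^sup>+t\<in>{0..}. ennreal (exp (2 * \<alpha> / 3 * t) * (norm (gradient f (x t)))\<^sup>2) \<partial>lborel) < \<infinity>"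
proof -

  \<comment> \<open>The energy along the trajectory\<close>
  obtain z where z: "f z = fstar" using assms(4) by blast
  have \<alpha>: "\<alpha> > 0" and m: "m > 0" using assms(6,7) by auto
  have "(\<alpha> / 3)\<^sup>2 \<le> (sqrt (\<mu> * m / 2))\<^sup>2"
    using assms(7) \<alpha> by (intro power_mono) auto
  then have \<alpha>2: "\<alpha>\<^sup>2 / 9 \<le> \<mu> * m / 2"
    using assms(1) m by (simp add: power_divide)
  define \<delta> where "\<delta> = 1 + \<alpha> * \<beta> / 3"
  define r where "r = 2 * \<alpha> / 3"
  define \<kappa> where "\<kappa> = \<alpha> * m * \<beta>\<^sup>2 / 3"
  define g where "g t = gradient f (x t)" for t
  define F where "F t = f (x t) - fstar" for t
  define y where "y t = x t - z" for t
  define w where "w t = x' t + \<beta> *\<^sub>R g t" for t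
  define v where "v t = r *\<^sub>R y t + w t" for t
  \<comment> \<open>The last term is \<open>\<alpha>\<^sup>2 / 9 * (norm (y t))\<^sup>2\<close>,
    written with a half square so that \<open>has_real_derivative_half_norm_square\<close> applies
    to it.\<close>
  define E where "E t = m * \<delta> * F t + (norm (v t))\<^sup>2 / 2 - 2 * \<alpha>\<^sup>2 / 9 * ((norm (y t))\<^sup>2 / 2)" for t
  define E' where "E' t = m * \<delta> * inner (x' t) (g t) + inner (v t) (- (\<alpha> / 3) *\<^sub>R w t - (m * \<delta>) *\<^sub>R g t)
    - 2 * \<alpha>\<^sup>2 / 9 * inner (y t) (x' t)" for t
  have \<kappa>: "\<kappa> > 0" unfolding \<kappa>_def using \<alpha> m assms(8) by simp
  have dx: "(x has_vector_derivative x' t) (at t within {0..})" if "t \<ge> 0" for t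
    using assms(10) that by blast
  have dg: "(g has_vector_derivative hessian f (x t) (x' t)) (at t within {0..})" if "t \<ge> 0" for t
    using vector_derivative_diff_chain_within[OF dx[OF that] has_derivative_at_withinI[OF
          twice_differentiable_has_derivative_hessian[OF assms(3)]]]
    by (simp add: g_def[abs_def] o_def)
  have dF: "(F has_real_derivative inner (x' t) (g t)) (at t within {0..})" if "t \<ge> 0" for t
  proof -
    have "GDERIV f (x t) :> g t"
      unfolding g_def using assms(3)
      by (intro differentiable_GDERIV_gradient) (simp add: twice_differentiable_def)
    from has_vector_derivative_GDERIV_compose[OF dx[OF that] this] show ?thesis
      unfolding F_def by (auto intro!: derivative_eq_intros)
  qed
  have dy: "(y has_vector_derivative x' t) (at t within {0..})" if "t \<ge> 0" for t
    unfolding y_def using dx[OF that] by (auto intro!: derivative_eq_intros)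
  have dv: "(v has_vector_derivative - (\<alpha> / 3) *\<^sub>R w t - (m * \<delta>) *\<^sub>R g t) (at t within {0..})"
    if "t \<ge> 0" for t
  proof -
    have x'': "x'' t = - (\<alpha> *\<^sub>R x' t + \<beta> *\<^sub>R hessian f (x t) (x' t) + \<gamma> *\<^sub>R g t)"
      using assms(12)[rule_format, OF that] unfolding g_def eq_neg_iff_add_eq_0 by (simp only: add.assoc)
    \<comment> \<open>The derivative of \<open>\<beta> *\<^sub>R g\<close> is the Hessian term of
      the equation, so substituting \<open>x''\<close> removes it.\<close>
    have "(v has_vector_derivative r *\<^sub>R x' t + (x'' t + \<beta> *\<^sub>R hessian f (x t) (x' t))) (at t within {0..})"
      unfolding v_def w_def using dy[OF that] dg[OF that] assms(11) that
      by (auto intro!: derivative_eq_intros)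
    moreover have "r *\<^sub>R x' t + (x'' t + \<beta> *\<^sub>R hessian f (x t) (x' t)) = - (\<alpha> / 3) *\<^sub>R w t - (m * \<delta>) *\<^sub>R g t"
    proof -
      have "r *\<^sub>R x' t + (x'' t + \<beta> *\<^sub>R hessian f (x t) (x' t)) = (r - \<alpha>) *\<^sub>R x' t - \<gamma> *\<^sub>R g t"
        unfolding x'' by (simp add: algebra_simps)
      moreover have "- (\<alpha> / 3) *\<^sub>R w t - (m * \<delta>) *\<^sub>R g t
          = (- (\<alpha> / 3)) *\<^sub>R x' t - (\<alpha> * \<beta> / 3 + m * \<delta>) *\<^sub>R g t"
        unfolding w_def by (simp add: algebra_simps)
      moreover have "r - \<alpha> = - (\<alpha> / 3)" "\<gamma> = \<alpha> * \<beta> / 3 + m * \<delta>"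
        unfolding r_def \<delta>_def assms(9) by (simp_all add: algebra_simps)
      ultimately show ?thesis by metis
    qed
    ultimately show ?thesis by simp
  qed
  have dE: "(E has_real_derivative E' t) (at t within {0..})" if "t \<ge> 0" for t
    unfolding E_def E'_def
    using dF[OF that] has_real_derivative_half_norm_square[OF dv[OF that]]
      has_real_derivative_half_norm_square[OF dy[OF that]]
    by (intro DERIV_diff DERIV_add DERIV_cmult)
  have decay: "E' t + r * E t \<le> - \<kappa> * (norm (g t))\<^sup>2" if "t \<ge> 0" for t
  proof -
    \<comment> \<open>Strong convexity is based at \<open>x t\<close> and evaluated at
      \<open>z\<close>, the reverse of its use for quadratic growth.\<close>
    have "f z \<ge> f (x t) + inner (g t) (z - x t) + \<mu> / 2 * (norm (x t - z))\<^sup>2"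
      using assms(2) unfolding strongly_convex_def g_def by blast
    then have F: "F t \<le> inner (y t) (g t) - \<mu> / 2 * (norm (y t))\<^sup>2"
      unfolding F_def y_def z by (simp add: inner_diff_left inner_diff_right inner_commute)
    have x': "x' t = w t - \<beta> *\<^sub>R g t" unfolding w_def by simp
    \<comment> \<open>After \<open>x' = w - \<beta> g\<close> the coefficients of
      \<open>inner w g\<close>, \<open>inner w w\<close> and \<open>inner y w\<close> vanish: the
      second because \<open>r / 2 = \<alpha> / 3\<close>, the third because
      \<open>r\<^sup>2 = r * \<alpha> / 3 + 2 * \<alpha>\<^sup>2 / 9\<close>.\<close>
    have "E' t + r * E t = 2 * \<alpha> / 3 * (m * \<delta> * F t - (m * \<delta> - \<alpha> * \<beta> / 3) * inner (y t) (g t)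
        + \<alpha>\<^sup>2 / 9 * (norm (y t))\<^sup>2) - m * \<delta> * \<beta> * (norm (g t))\<^sup>2"
      unfolding E'_def E_def v_def x' r_def power2_norm_eq_inner
      by (simp add: inner_diff_left inner_diff_right inner_add_left inner_add_right inner_commute
          field_simps power2_eq_square)
    also have "\<dots> \<le> - (\<kappa> * (norm (g t))\<^sup>2)"
      using energy_inequality[OF \<alpha> assms(8,1,6) \<alpha>2 F] unfolding \<delta>_def \<kappa>_def .
    finally show ?thesis by simp
  qed
  have growth: "\<alpha>\<^sup>2 / 9 * (norm (y t))\<^sup>2 \<le> m * F t" for t
  proof -
    have "\<mu> / 2 * (norm (y t))\<^sup>2 \<le> F t"
      unfolding y_def F_def z[symmetric]
      using assms(2,5) z by (intro strongly_convex_quadratic_growth) auto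
    then have "m * (\<mu> / 2 * (norm (y t))\<^sup>2) \<le> m * F t" using m by simp
    moreover have "\<alpha>\<^sup>2 / 9 * (norm (y t))\<^sup>2 \<le> \<mu> * m / 2 * (norm (y t))\<^sup>2"
      by (intro mult_right_mono \<alpha>2) simp
    ultimately show ?thesis by (simp add: algebra_simps)
  qed
  have E_ge: "m * (\<alpha> * \<beta> / 3) * F t \<le> E t" for t
    using growth[of t] unfolding E_def \<delta>_def by (simp add: algebra_simps add_increasing2)
  have "v 0 = r *\<^sub>R y 0" unfolding v_def w_def g_def using assms(13-15) by simp
  \<comment> \<open>Since \<open>r\<^sup>2 / 2 = 2 * \<alpha>\<^sup>2 / 9\<close>, the two quadratic
    terms leave a net positive \<open>\<alpha>\<^sup>2 / 9\<close>.\<close>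
  then have "E 0 = m * \<delta> * F 0 + \<alpha>\<^sup>2 / 9 * (norm (y 0))\<^sup>2"
    unfolding E_def r_def by (simp add: power_mult_distrib power_divide)
  then have E0: "E 0 \<le> m * (2 + \<alpha> * \<beta> / 3) * F 0"
    using growth[of 0] unfolding \<delta>_def by (simp add: algebra_simps)

  \<comment> \<open>Integration of the differential inequality\<close>
  define h where "h t = exp (r * t) * (norm (g t))\<^sup>2" for t
  have "continuous_on {0..} g"
    using dg by (intro continuous_on_vector_derivative) auto
  then have h_cont: "continuous_on {0..} h" unfolding h_def by (intro continuous_intros)
  have h_nonneg: "h t \<ge> 0" for t unfolding h_def by simp
  \<comment> \<open>This bound is used twice: dropping the integral gives the decay rate, dropping
    \<open>exp (r * T) * E T\<close> gives integrability.\<close>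
  have bound: "integral {0..T} (\<lambda>t. \<kappa> * h t) \<le> E 0 - exp (r * T) * E T" if "T \<ge> 0" for T
  proof -
    have "integral {0..T} (\<lambda>t. \<kappa> * h t) \<le> exp (r * 0) * E 0 - exp (r * T) * E T"
    proof (rule integral_le_of_derivative_le[where \<Psi> = "\<lambda>t. exp (r * t) * E t"])
      fix t :: real assume t: "t \<ge> 0"
      show "((\<lambda>t. exp (r * t) * E t) has_real_derivative exp (r * t) * (E' t + r * E t)) (at t within {0..})"
        by (auto intro!: derivative_eq_intros dE[OF t] simp: algebra_simps)
      have "exp (r * t) * (E' t + r * E t) \<le> exp (r * t) * (- \<kappa> * (norm (g t))\<^sup>2)"
        by (intro mult_left_mono decay t) simp
      then show "exp (r * t) * (E' t + r * E t) \<le> - (\<kappa> * h t)" unfolding h_def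
        by (simp add: mult.left_commute)
    qed (use that h_cont in \<open>auto intro: continuous_intros\<close>)
    then show ?thesis by simp
  qed
  have "f (x t) - fstar \<le> (1 + 6 / (\<alpha> * \<beta>)) * (f x0 - fstar) * exp (- (2 / 3) * \<alpha> * t)"
    if t: "t \<ge> 0" for t
  proof -
    have "0 \<le> integral {0..t} (\<lambda>t. \<kappa> * h t)"
      using \<kappa> h_nonneg h_cont
      by (intro integral_nonneg integrable_continuous_real continuous_intros
          continuous_on_subset[OF h_cont]) auto
    then have "exp (r * t) * E t \<le> m * (2 + \<alpha> * \<beta> / 3) * F 0" using bound[OF t] E0 by linarith
    \<comment> \<open>The constant of the theorem is the quotient of the upper factor
      \<open>m * (2 + \<alpha> * \<beta> / 3)\<close> by the lower factor
      \<open>m * (\<alpha> * \<beta> / 3)\<close>.\<close>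
    also have "\<dots> = m * (\<alpha> * \<beta> / 3) * ((1 + 6 / (\<alpha> * \<beta>)) * F 0)"
      using \<alpha> assms(8) by (simp add: field_simps)
    finally have upper: "exp (r * t) * E t \<le> m * (\<alpha> * \<beta> / 3) * ((1 + 6 / (\<alpha> * \<beta>)) * F 0)" .
    have "m * (\<alpha> * \<beta> / 3) * (exp (r * t) * F t) = exp (r * t) * (m * (\<alpha> * \<beta> / 3) * F t)"
      by (rule mult.left_commute)
    also have "\<dots> \<le> exp (r * t) * E t"
      by (intro mult_left_mono E_ge) simp
    also note upper
    finally have "m * (\<alpha> * \<beta> / 3) * (exp (r * t) * F t) \<le> m * (\<alpha> * \<beta> / 3) * ((1 + 6 / (\<alpha> * \<beta>)) * F 0)" .
    then have "exp (r * t) * F t \<le> (1 + 6 / (\<alpha> * \<beta>)) * F 0"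
      using m \<alpha> assms(8) by (subst (asm) mult_le_cancel_left_pos) auto
    then have "F t \<le> (1 + 6 / (\<alpha> * \<beta>)) * F 0 * exp (- (r * t))"
      by (simp add: exp_minus field_simps)
    then show ?thesis unfolding F_def r_def using assms(13) by simp
  qed
  moreover have "(\<integral>\<^sup>+t\<in>{0..}. ennreal (h t) \<partial>lborel) \<le> ennreal (E 0 / \<kappa>)"
  proof (rule nn_integral_atLeast_le[OF h_cont h_nonneg])
    fix T :: real assume T: "T \<ge> 0"
    \<comment> \<open>Nonnegativity of \<open>F T\<close> is read off \<open>growth\<close>, whose
      left side is a square times a nonnegative factor.\<close>
    have "0 \<le> m * F T" by (rule order_trans[OF _ growth]) simp
    then have "0 \<le> m * (\<alpha> * \<beta> / 3) * F T" using m \<alpha> assms(8) by (simp add: zero_le_mult_iff)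
    then have "0 \<le> E T" using E_ge[of T] by linarith
    then have "0 \<le> exp (r * T) * E T" by simp
    then have "\<kappa> * integral {0..T} h \<le> E 0" using bound[OF T] by simp
    then show "integral {0..T} h \<le> E 0 / \<kappa>" using \<kappa> by (simp add: field_simps)
  qed
  then have "(\<integral>\<^sup>+t\<in>{0..}. ennreal (h t) \<partial>lborel) < \<infinity>"
    using ennreal_less_top le_less_trans by (metis infinity_ennreal_def)
  ultimately show ?thesis unfolding h_def r_def g_def by blast
qed

end
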